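(* Let $d=1$, let $C=[c_1,c_2]$ with $c_1<c_2$, and assume that $f$ is bounded away from zero on $C$ and twice differentiable at every point of $C$. Assume that $K$ is a bounded nonnegative function on $\mathbb{R}$ with $\int_{\mathbb{R}}K(z)\,dz=1$, $\int_{\mathbb{R}}zK(z)\,dz=0$, $\int_{\mathbb{R}}z^2|K(z)|\,dz<\infty$, and that $K$ is absolutely continuous on $\mathbb{R}$ with $0<\int_{\mathbb{R}}K'^2(t)\,dt<\infty$. Let $h_n=n^{-a}$ with $a\in\left(\frac15,\frac12\right)$, let $\alpha\in(0,1)$, let $z_\alpha$ be defined by $\exp(-2\exp(-z_\alpha))=1-\alpha$, and set, for $n\geq 2$ and $x\in C$, $$u_n=\frac{1}{\sqrt2\log(1/h_n)}\left\{\log\left[\frac{1}{2\pi}\sqrt{\frac{\int_{\mathbb{R}}K'^2(t)\,dt}{\kappa}}\right]+\log\left[\frac{c_2-c_1}{\pi}\right]\right\},$$ $$\ell_n=\sqrt{\log(1/h_n)}\left(\sqrt2+u_n+\frac{z_\alpha}{\sqrt2\log(1/h_n)}\right),$$ $$I_n(x)=\left[f_n(x)-\frac{\sqrt{f_n(x)\kappa}}{\sqrt{nh_n}}\,\ell_n\,;\,f_n(x)+\frac{\sqrt{f_n(x)\kappa}}{\sqrt{nh_n}}\,\ell_n\right].$$ Then, for every $x\in C$, the logarithmic asymptotic level of the sequence of confidence intervals $(I_n(x))$ of $f(x)$ is $1$ with speed $\log(1/h_n)$, that is, $$\lim_{n\to\infty}\frac{1}{\log(1/h_n)}\log\mathbb{P}\left(f(x)\notin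 I_n(x)\right)=-1 .$$
   Context: Setting: $X_1,X_2,\dots$ are independent identically distributed real random variables with bounded probability density $f$. The kernel $K$ also satisfies $\lim_{|z|\to\infty}K(z)=0$. The kernel density estimator is $f_n(x)=\frac{1}{nh_n}\sum_{j=1}^nK\left(\frac{x-X_j}{h_n}\right)$, and $\kappa=\int_{\mathbb{R}}K^2(z)\,dz$. *)

theory Defs
  imports "HOL-Probability.Probability"
begin

definition kernel_density_estimator ::
    "(real \<Rightarrow> real) \<Rightarrow> (nat \<Rightarrow> real) \<Rightarrow> (nat \<Rightarrow> 'a \<Rightarrow> real) \<Rightarrow> nat \<Rightarrow> real \<Rightarrow> 'a \<Rightarrow> real" where
  "kernel_density_estimator K h X n x \<omega> =
     1 / (real n * h n) * (\<Sum>j = 1..n. K ((x - X j \<omega>) / h n))"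

(* Absolute continuity of a real function, in the sense of finite families of
   non-overlapping intervals; the library's constant absolutely_continuous is
   the unrelated notion for measures. *)
definition absolutely_continuous_fun_on :: "real set \<Rightarrow> (real \<Rightarrow> real) \<Rightarrow> bool" where
  "absolutely_continuous_fun_on S g \<longleftrightarrow>
     (\<forall>\<epsilon>>0. \<exists>\<delta>>0. \<forall>(N::nat) a b.
        (\<forall>i<N. a i \<le> b i \<and> {a i..b i} \<subseteq> S) \<longrightarrow>
        disjoint_family_on (\<lambda>i. {a i<..<b i}) {..<N} \<longrightarrow>
        (\<Sum>i<N. b i - a i) < \<delta> \<longrightarrow>
        (\<Sum>i<N. \<bar>g (b i) - g (a i)\<bar>) < \<epsilon>)"

definition twice_differentiable_at :: "(real \<Rightarrow> real) \<Rightarrow> real \<Rightarrow> bool" where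
  "twice_differentiable_at g x \<longleftrightarrow>
     (\<forall>\<^sub>F y in nhds x. g differentiable at y) \<and> deriv g differentiable at x"

(* The library convention ln 0 = 0 is harmless for gamma > 0: if the non-coverage
   probability vanished for infinitely many n, the quotient would be 0 there,
   and the limit could not be - gamma. *)
definition (in prob_space) has_log_asymptotic_level ::
    "(nat \<Rightarrow> 'a \<Rightarrow> real set) \<Rightarrow> real \<Rightarrow> real \<Rightarrow> (nat \<Rightarrow> real) \<Rightarrow> bool" where
  "has_log_asymptotic_level I \<theta> \<gamma> v \<longleftrightarrow>
     (\<lambda>n. 1 / v n * ln (prob {\<omega> \<in> space M. \<theta> \<notin> I n \<omega>})) \<longlonglongrightarrow> - \<gamma>"

end

(* In units of its standard deviation times sqrt (log (1/h_n)), the error Z_n of the estimator at x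
   has Gaussian cumulants at speed b_n = log (1/h_n): (1/b_n) log E exp (t b_n Z_n) tends to t^2/2.
   This needs only a second-order expansion of one summand, since n h_n^5 / b_n tends to 0 (a > 1/5)
   kills the bias and b_n / (n h_n) tends to 0 kills the higher cumulants. The moderate deviation
   principle P(Z_n >= c) = exp (- b_n (c^2/2 + o(1))) follows as in the Gaertner-Ellis theorem.
   Up to factors tending to 1, f x lies outside I_n iff the absolute value of Z_n exceeds sqrt 2,
   because l_n / sqrt b_n tends to sqrt 2, and (sqrt 2)^2 / 2 = 1. *)

theory Submission
  imports Defs "HOL-Real_Asymp.Real_Asymp"
begin

text \<open>The half-width of the interval contains the estimate itself, so non-coverage is not an
  event about Z_n and a fixed threshold. It is sandwiched instead: for each c > sqrt 2 it eventually
  contains {Z_n >= c}, and for each c in (0, sqrt 2) it is eventually contained in {|Z_n| >= c},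
  because the unit of Z_n, q_n = sqrt (\<kappa> f(x) b_n / (n h_n)), tends to 0. Since c^2/2 is
  continuous in c, the sandwich loses nothing on the logarithmic scale. A summand K((x - X_j)/h_n)
  has second moment about h_n \<kappa> f(x). In the exponential moment of order \<eta> it carries
  the factor s_n = \<eta> q_n / (\<kappa> f(x)), and n s_n^2 h_n \<kappa> f(x) / (2 b_n) is exactly
  \<eta>^2/2. As s_n tends to 0 and K is bounded, expanding the exponential is legitimate. The
  squared mean of a summand is only of order h_n^2, so its second moment may stand for its
  variance.\<close>

section \<open>Local expansion of kernel moments\<close>

text \<open>The bound has to hold for all t, not only near 0, because it is integrated against a
  kernel without compact support. Near x it comes from the mean value inequality, far from x from
  boundedness of \<open>f\<close>.\<close>

lemma twice_differentiable_at_quadratic_remainder: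
  assumes "twice_differentiable_at f x" and "bounded (range f)"
  shows "\<exists>A. \<forall>t. \<bar>f (x + t) - f x - deriv f x * t\<bar> \<le> A * t\<^sup>2"
proof -
  obtain d1 where d1: "d1 > 0" "\<And>y. dist y x < d1 \<Longrightarrow> f differentiable at y"
    using assms(1) unfolding twice_differentiable_at_def eventually_nhds_metric by blast
  obtain D where D: "(deriv f has_real_derivative D) (at x)"
    using assms(1) unfolding twice_differentiable_at_def real_differentiable_def by blast
  then obtain d2 where d2: "d2 > 0"
    "\<And>y. norm (y - x) < d2 \<Longrightarrow> norm (deriv f y - deriv f x - D * (y - x)) \<le> 1 * norm (y - x)"
    unfolding has_field_derivative_def has_derivative_within_alt by (metis UNIV_I zero_less_one)
  define d where "d = min d1 d2 / 2"
  have d: "d > 0" "d < d1" "d < d2" using d1 d2 by (auto simp: d_def)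
  obtain B where B: "\<And>y. \<bar>f y\<bar> \<le> B" using assms(2) by (auto simp: bounded_iff)
  \<comment> \<open>The first entry serves |t| \<le> d: \<open>D\<close> is the second derivative,
    and the 1 is the tolerance chosen in its definition. The second serves |t| > d, where 1 <
    t^2/d^2 and |t| < t^2/d.\<close>
  define A where "A = max (\<bar>D\<bar> + 1) (2 * B / d\<^sup>2 + \<bar>deriv f x\<bar> / d)"
  have "\<bar>f (x + t) - f x - deriv f x * t\<bar> \<le> A * t\<^sup>2" for t
  proof (cases "\<bar>t\<bar> \<le> d")
    case True
    let ?g = "\<lambda>y. f y - deriv f x * y"
    \<comment> \<open>The ball has radius |t| rather than \<open>d\<close>, so that the bound on the
      derivative is itself linear in |t| and the product is quadratic.\<close>
    have "norm (?g (x + t) - ?g x) \<le> ((\<bar>D\<bar> + 1) * \<bar>t\<bar>) * norm ((x + t) - x)"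
    proof (rule field_differentiable_bound[where S = "cball x \<bar>t\<bar>"])
      fix y assume "y \<in> cball x \<bar>t\<bar>"
      then have y: "\<bar>y - x\<bar> \<le> \<bar>t\<bar>" by (simp add: dist_real_def abs_minus_commute)
      have "f differentiable at y" using y True d by (intro d1(2)) (simp add: dist_real_def)
      then have "(f has_real_derivative deriv f y) (at y)"
        by (metis DERIV_imp_deriv real_differentiable_def)
      then show "(?g has_real_derivative (deriv f y - deriv f x)) (at y within cball x \<bar>t\<bar>)"
        by (auto intro!: derivative_eq_intros intro: has_field_derivative_at_within)
      have "\<bar>deriv f y - deriv f x - D * (y - x)\<bar> \<le> \<bar>y - x\<bar>" using d2(2)[of y] y True d by simp
      then have "\<bar>deriv f y - deriv f x\<bar> \<le> \<bar>y - x\<bar> + \<bar>D * (y - x)\<bar>" by linarith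
      also have "\<dots> = (\<bar>D\<bar> + 1) * \<bar>y - x\<bar>" by (simp only: abs_mult distrib_right) simp
      also have "\<dots> \<le> (\<bar>D\<bar> + 1) * \<bar>t\<bar>" using y by (intro mult_left_mono) auto
      finally show "norm (deriv f y - deriv f x) \<le> (\<bar>D\<bar> + 1) * \<bar>t\<bar>" by simp
    qed (auto simp: dist_real_def)
    then have "\<bar>f (x + t) - f x - deriv f x * t\<bar> \<le> (\<bar>D\<bar> + 1) * t\<^sup>2"
      by (simp add: algebra_simps power2_eq_square)
    also have "\<dots> \<le> A * t\<^sup>2" by (intro mult_right_mono) (auto simp: A_def)
    finally show ?thesis .
  next
    case False
    have B0: "B \<ge> 0" using B[of x] by linarith
    have "1 \<le> \<bar>t\<bar> / d" using False d by simp
    then have t1: "\<bar>t\<bar> \<le> t\<^sup>2 / d" and t2: "1 \<le> t\<^sup>2 / d\<^sup>2"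
      using mult_left_mono[of 1 "\<bar>t\<bar> / d" "\<bar>t\<bar>"] power_mono[of 1 "\<bar>t\<bar> / d" 2]
      by (auto simp: power2_eq_square power_divide)
    have "\<bar>f (x + t) - f x - deriv f x * t\<bar> \<le> 2 * B + \<bar>deriv f x\<bar> * \<bar>t\<bar>"
      using B[of "x + t"] B[of x] abs_mult[of "deriv f x" t] by linarith
    also have "\<dots> \<le> 2 * B * (t\<^sup>2 / d\<^sup>2) + \<bar>deriv f x\<bar> * (t\<^sup>2 / d)"
      using B0 t1 mult_left_mono[OF t2, of "2 * B"] by (intro add_mono mult_left_mono) auto
    also have "\<dots> = (2 * B / d\<^sup>2 + \<bar>deriv f x\<bar> / d) * t\<^sup>2" by (simp add: algebra_simps)
    also have "\<dots> \<le> A * t\<^sup>2" by (intro mult_right_mono) (auto simp: A_def)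
    finally show ?thesis .
  qed
  then show ?thesis by blast
qed

text \<open>Substituting y = x - h t turns the expectation into h times the integral of f(x - h t)
  G(t). It is used with \<open>G\<close> equal to K and to K^2. For K the linear term vanishes and
  the bias is O(h^2). For K^2 the linear term of order h remains, which is enough for a
  limit.\<close>

lemma (in prob_space) expectation_kernel_expansion:
  fixes X :: "'a \<Rightarrow> real" and f G :: "real \<Rightarrow> real"
  assumes X: "distributed M lborel X (\<lambda>x. ennreal (f x))"
    and f0: "\<And>x. 0 \<le> f x" and fb: "bounded (range f)"
    and A: "\<And>t. \<bar>f (x + t) - f x - D * t\<bar> \<le> A * t\<^sup>2"
    and G0: "\<And>t. 0 \<le> G t"
    and G: "integrable lborel G" and G1: "integrable lborel (\<lambda>t. t * G t)"
    and G2: "integrable lborel (\<lambda>t. t\<^sup>2 * G t)"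
    and h: "h > 0"
  shows "\<bar>expectation (\<lambda>\<omega>. G ((x - X \<omega>) / h)) / h
           - (f x * (\<integral>t. G t \<partial>lborel) - D * h * (\<integral>t. t * G t \<partial>lborel))\<bar>
         \<le> A * h\<^sup>2 * (\<integral>t. t\<^sup>2 * G t \<partial>lborel)"
proof -
  \<comment> \<open>Measurability of the density is known only for its \<open>ennreal\<close>
    version; nonnegativity carries it back to \<open>f\<close>.\<close>
  have [measurable]: "f \<in> borel_measurable borel"
  proof -
    have "(\<lambda>x. enn2real (ennreal (f x))) \<in> borel_measurable lborel"
      using distributed_borel_measurable[OF X] by measurable
    then show ?thesis using f0 by simp
  qed
  have [measurable]: "G \<in> borel_measurable borel"
    using borel_measurable_integrable[OF G] by simp
  obtain B where B: "\<And>y. \<bar>f y\<bar> \<le> B" using fb by (auto simp: bounded_iff)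
  have "expectation (\<lambda>\<omega>. G ((x - X \<omega>) / h)) = (\<integral>y. f y * G ((x - y) / h) \<partial>lborel)"
    by (rule distributed_integral[symmetric, OF X]) (auto simp: f0)
  also have "\<dots> = h * (\<integral>t. f (x - h * t) * G t \<partial>lborel)"
    using lborel_integral_real_affine[of "-h" "\<lambda>y. f y * G ((x - y) / h)" x] h
    by simp
  finally have E: "expectation (\<lambda>\<omega>. G ((x - X \<omega>) / h)) / h = (\<integral>t. f (x - h * t) * G t \<partial>lborel)"
    using h by simp
  have i: "integrable lborel (\<lambda>t. f (x - h * t) * G t)"
  proof (rule Bochner_Integration.integrable_bound)
    show "integrable lborel (\<lambda>t. B * G t)" using G by simp
    show "AE t in lborel. norm (f (x - h * t) * G t) \<le> norm (B * G t)"
      using B G0 by (auto simp: abs_mult intro!: AE_I2 mult_right_mono order_trans[OF B])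
  qed measurable
  have j: "integrable lborel (\<lambda>t. f x * G t - D * h * (t * G t))" using G G1 by simp
  have "(\<integral>t. f (x - h * t) * G t \<partial>lborel) - (f x * (\<integral>t. G t \<partial>lborel) - D * h * (\<integral>t. t * G t \<partial>lborel))
      = (\<integral>t. f (x - h * t) * G t - (f x * G t - D * h * (t * G t)) \<partial>lborel)"
    using i j G G1 by (simp add: Bochner_Integration.integral_diff)
  also have "\<bar>\<dots>\<bar> \<le> (\<integral>t. A * h\<^sup>2 * (t\<^sup>2 * G t) \<partial>lborel)"
  proof (rule integral_abs_bound[THEN order_trans], rule integral_mono)
    show "integrable lborel (\<lambda>t. \<bar>f (x - h * t) * G t - (f x * G t - D * h * (t * G t))\<bar>)"
      using i j by simp
    show "integrable lborel (\<lambda>t. A * h\<^sup>2 * (t\<^sup>2 * G t))" using G2 by simp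
    fix t
    have "\<bar>f (x - h * t) * G t - (f x * G t - D * h * (t * G t))\<bar>
        = \<bar>f (x + (- h * t)) - f x - D * (- h * t)\<bar> * G t"
      using G0[of t] by (subst abs_mult_pos) (simp_all add: algebra_simps)
    also have "\<dots> \<le> A * (- h * t)\<^sup>2 * G t" by (intro mult_right_mono A G0)
    finally show "\<bar>f (x - h * t) * G t - (f x * G t - D * h * (t * G t))\<bar> \<le> A * h\<^sup>2 * (t\<^sup>2 * G t)"
      by (simp add: power_mult_distrib mult_ac)
  qed
  finally show ?thesis unfolding E by simp
qed

section \<open>Log moment generating function of one bounded summand\<close>

lemma exp_quadratic_remainder:
  fixes u :: real assumes "\<bar>u\<bar> \<le> 1"
  shows "\<bar>exp u - 1 - u - u\<^sup>2 / 2\<bar> \<le> \<bar>u\<bar> ^ 3"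
proof -
  obtain t where t: "\<bar>t\<bar> \<le> \<bar>u\<bar>" "exp u = (\<Sum>m<3. u ^ m / fact m) + exp t / fact 3 * u ^ 3"
    using Maclaurin_exp_le by blast
  have "exp t \<le> exp 1" using t assms by simp
  then have "exp t / 6 \<le> 1" using exp_le by linarith
  have "exp u - 1 - u - u\<^sup>2 / 2 = exp t / 6 * u ^ 3"
    using t(2) by (simp add: numeral_3_eq_3 fact_numeral power2_eq_square)
  then have "\<bar>exp u - 1 - u - u\<^sup>2 / 2\<bar> = exp t / 6 * \<bar>u\<bar> ^ 3"
    by (simp only: abs_mult power_abs) simp
  also have "\<dots> \<le> 1 * \<bar>u\<bar> ^ 3" by (intro mult_right_mono) (use \<open>exp t / 6 \<le> 1\<close> in auto)
  finally show ?thesis by simp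
qed

text \<open>The error is expressed through \<open>m1\<close> and \<open>m2\<close>, not through
  powers of \<open>B\<close> alone, because both moments are of order h in the application. The
  cubic term of exp gives the first error, by Y^3 \<le> B Y^2. The second is 2 w^2 from ln (1 + w),
  with |w| \<le> 3 |s| m1; the factor 6 in the hypothesis makes |w| \<le> 1/2.\<close>

lemma (in prob_space) ln_mgf_quadratic_expansion:
  fixes Y :: "'a \<Rightarrow> real" and s B :: real
  assumes Y[measurable]: "random_variable borel Y" and Y0: "\<And>\<omega>. 0 \<le> Y \<omega>" and YB: "\<And>\<omega>. Y \<omega> \<le> B"
    and s: "6 * \<bar>s\<bar> * B \<le> 1"
  defines "m1 \<equiv> expectation Y" and "m2 \<equiv> expectation (\<lambda>\<omega>. (Y \<omega>)\<^sup>2)"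
  shows "\<bar>ln (expectation (\<lambda>\<omega>. exp (s * Y \<omega>))) - s * m1 - s\<^sup>2 / 2 * m2\<bar>
         \<le> \<bar>s\<bar> ^ 3 * B * m2 + 18 * s\<^sup>2 * m1\<^sup>2"
proof -
  have B0: "B \<ge> 0" using Y0 YB order_trans by blast
  have sB: "\<bar>s\<bar> * B \<le> 1" using s by simp
  have iY: "integrable M Y"
    by (rule integrable_const_bound[where B = B]) (auto simp: Y0 YB)
  have iY2: "integrable M (\<lambda>\<omega>. (Y \<omega>)\<^sup>2)"
    by (rule integrable_const_bound[where B = "B\<^sup>2"]) (auto simp: Y0 YB power_mono)
  have sY: "\<bar>s * Y \<omega>\<bar> \<le> \<bar>s\<bar> * B" for \<omega>
    using Y0[of \<omega>] YB[of \<omega>] by (auto simp: abs_mult intro!: mult_left_mono)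
  have ie: "integrable M (\<lambda>\<omega>. exp (s * Y \<omega>))"
  proof (rule integrable_const_bound[where B = "exp 1"])
    show "AE \<omega> in M. norm (exp (s * Y \<omega>)) \<le> exp 1"
      using order_trans[OF sY sB] by (auto intro!: AE_I2 simp: abs_le_iff)
  qed measurable
  have m: "0 \<le> m1" "m1 \<le> B" "0 \<le> m2" "m2 \<le> B * m1"
  proof -
    show "0 \<le> m1" "0 \<le> m2" unfolding m1_def m2_def using Y0 by auto
    show "m1 \<le> B" unfolding m1_def
      using integral_mono[OF iY integrable_const[of B]] YB by (simp add: prob_space)
    have "m2 \<le> expectation (\<lambda>\<omega>. B * Y \<omega>)" unfolding m2_def
      using iY iY2 Y0 YB by (intro integral_mono) (auto simp: power2_eq_square intro!: mult_right_mono)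
    then show "m2 \<le> B * m1" by (simp add: m1_def)
  qed
  define w where "w = expectation (\<lambda>\<omega>. exp (s * Y \<omega>)) - 1"
  have "w - s * m1 - s\<^sup>2 / 2 * m2
      = expectation (\<lambda>\<omega>. exp (s * Y \<omega>) - 1 - s * Y \<omega> - s\<^sup>2 / 2 * (Y \<omega>)\<^sup>2)"
    using iY iY2 ie by (simp add: w_def m1_def m2_def Bochner_Integration.integral_diff prob_space)
  also have "\<bar>\<dots>\<bar> \<le> expectation (\<lambda>\<omega>. \<bar>s\<bar> ^ 3 * B * (Y \<omega>)\<^sup>2)"
  proof (rule integral_abs_bound[THEN order_trans], rule integral_mono)
    fix \<omega>
    have "\<bar>exp (s * Y \<omega>) - 1 - s * Y \<omega> - (s * Y \<omega>)\<^sup>2 / 2\<bar> \<le> \<bar>s * Y \<omega>\<bar> ^ 3"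
      by (rule exp_quadratic_remainder) (use sY[of \<omega>] sB in linarith)
    also have "\<dots> = \<bar>s\<bar> ^ 3 * (Y \<omega> * (Y \<omega>)\<^sup>2)"
      using Y0[of \<omega>] by (simp add: abs_mult power_mult_distrib power2_eq_square power3_eq_cube)
    also have "\<dots> \<le> \<bar>s\<bar> ^ 3 * (B * (Y \<omega>)\<^sup>2)"
      using YB by (intro mult_left_mono mult_right_mono) auto
    finally show "\<bar>exp (s * Y \<omega>) - 1 - s * Y \<omega> - s\<^sup>2 / 2 * (Y \<omega>)\<^sup>2\<bar> \<le> \<bar>s\<bar> ^ 3 * B * (Y \<omega>)\<^sup>2"
      by (simp add: power_mult_distrib algebra_simps)
  qed (use iY iY2 ie in auto)
  also have "\<dots> = \<bar>s\<bar> ^ 3 * B * m2" by (simp add: m2_def)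
  finally have w1: "\<bar>w - s * m1 - s\<^sup>2 / 2 * m2\<bar> \<le> \<bar>s\<bar> ^ 3 * B * m2" .
  have ss: "s\<^sup>2 = \<bar>s\<bar> * \<bar>s\<bar>" by (simp add: power2_eq_square)
  \<comment> \<open>\<open>q\<close> and \<open>r\<close> bound the quadratic and cubic parts of w
    by multiples of the linear one: 1 + 1/2 + 1 \<le> 3.\<close>
  have q: "s\<^sup>2 * m2 \<le> \<bar>s\<bar> * m1"
  proof -
    have "s\<^sup>2 * m2 \<le> s\<^sup>2 * (B * m1)" using m by (intro mult_left_mono) auto
    also have "\<dots> = (\<bar>s\<bar> * B) * (\<bar>s\<bar> * m1)" unfolding ss by (simp only: mult_ac)
    also have "\<dots> \<le> 1 * (\<bar>s\<bar> * m1)" using sB m by (intro mult_right_mono) auto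
    finally show ?thesis by simp
  qed
  have r: "\<bar>s\<bar> ^ 3 * B * m2 \<le> s\<^sup>2 * m2"
  proof -
    have "\<bar>s\<bar> ^ 3 * B * m2 = (\<bar>s\<bar> * B) * (s\<^sup>2 * m2)"
      unfolding ss power3_eq_cube by (simp only: mult_ac)
    also have "\<dots> \<le> 1 * (s\<^sup>2 * m2)" using sB m by (intro mult_right_mono) auto
    finally show ?thesis by simp
  qed
  have sm: "\<bar>s * m1\<bar> = \<bar>s\<bar> * m1" using m by (simp add: abs_mult)
  have "0 \<le> s\<^sup>2 * m2" using m by simp
  then have w2: "\<bar>w\<bar> \<le> 3 * (\<bar>s\<bar> * m1)" using w1 q r sm by (simp add: abs_le_iff) linarith
  have "\<bar>s\<bar> * m1 \<le> \<bar>s\<bar> * B" using m by (intro mult_left_mono) auto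
  then have "\<bar>w\<bar> \<le> 1 / 2" using w2 s by linarith
  then have "\<bar>ln (1 + w) - w\<bar> \<le> 2 * w\<^sup>2" by (rule abs_ln_one_plus_x_minus_x_bound)
  also have "\<dots> \<le> 2 * (3 * (\<bar>s\<bar> * m1))\<^sup>2" using w2 power_mono[OF w2, of 2] by simp
  also have "\<dots> = 18 * s\<^sup>2 * m1\<^sup>2" by (simp add: power_mult_distrib)
  finally show ?thesis using w1 by (simp add: w_def)
qed

section \<open>Tail bounds from Gaussian cumulants at speed b\<close>

text \<open>Chernoff's bound with the exponent \<eta> = c, which minimises \<eta>^2/2 - \<eta>
  c.\<close>

lemma (in prob_space) gaussian_ldp_upper:
  fixes Z :: "nat \<Rightarrow> 'a \<Rightarrow> real"
  assumes Z[measurable]: "\<And>n. random_variable borel (Z n)"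
    and int: "\<And>\<eta> n. integrable M (\<lambda>\<omega>. exp (\<eta> * b n * Z n \<omega>))"
    and b: "filterlim b at_top sequentially"
    and lim: "\<And>\<eta>. (\<lambda>n. ln (expectation (\<lambda>\<omega>. exp (\<eta> * b n * Z n \<omega>))) / b n) \<longlonglongrightarrow> \<eta>\<^sup>2 / 2"
    and "c > 0" "\<epsilon> > 0"
  shows "\<forall>\<^sub>F n in sequentially. prob {\<omega> \<in> space M. c \<le> Z n \<omega>} \<le> exp (- b n * (c\<^sup>2 / 2 - \<epsilon>))"
proof -
  have "\<forall>\<^sub>F n in sequentially. b n > 0" using b by (simp add: filterlim_at_top_dense)
  moreover have "\<forall>\<^sub>F n in sequentially.
      ln (expectation (\<lambda>\<omega>. exp (c * b n * Z n \<omega>))) / b n < c\<^sup>2 / 2 + \<epsilon>"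
    using lim[of c] \<open>\<epsilon> > 0\<close> by (intro order_tendstoD) auto
  ultimately show ?thesis
  proof eventually_elim
    case (elim n)
    let ?E = "expectation (\<lambda>\<omega>. exp (c * b n * Z n \<omega>))"
    have "exp (c * b n * c) * prob {\<omega> \<in> space M. c \<le> Z n \<omega>}
        = expectation (\<lambda>\<omega>. exp (c * b n * c) * indicator {\<omega> \<in> space M. c \<le> Z n \<omega>} \<omega>)"
      by simp
    also have "\<dots> \<le> ?E"
      using elim(1) \<open>c > 0\<close>
      by (intro integral_mono int integrable_mult_right integrable_real_indicator)
        (auto simp: indicator_def emeasure_eq_measure)
    also have "?E \<le> exp (b n * (c\<^sup>2 / 2 + \<epsilon>))"
    proof (cases "?E > 0")
      case True
      have "ln ?E \<le> b n * (c\<^sup>2 / 2 + \<epsilon>)" using elim by (simp add: divide_less_eq mult_ac)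
      then show ?thesis using True by (metis exp_le_cancel_iff exp_ln)
    qed (auto intro: order_trans[of _ 0])
    finally have "prob {\<omega> \<in> space M. c \<le> Z n \<omega>}
        \<le> exp (b n * (c\<^sup>2 / 2 + \<epsilon>)) / exp (c * b n * c)" by (simp add: field_simps)
    also have "\<dots> = exp (- b n * (c\<^sup>2 / 2 - \<epsilon>))"
      by (simp flip: exp_diff) (simp add: algebra_simps power2_eq_square)
    finally show ?case .
  qed
qed

text \<open>Exponential tilting without a change of measure: with \<open>\<theta> = c + \<delta>\<close>, strict convexity of
  \<open>\<eta>\<^sup>2 / 2\<close> makes the parts of the exponential moment of order \<open>\<theta>\<close> coming from \<open>Z < c\<close> and
  \<open>Z > c + 2 * \<delta>\<close> negligible, as seen from the moments of order \<open>\<theta> - \<delta>\<close> and \<open>\<theta> + \<delta>\<close>.\<close>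

lemma (in prob_space) gaussian_ldp_lower:
  fixes Z :: "nat \<Rightarrow> 'a \<Rightarrow> real"
  assumes Z[measurable]: "\<And>n. random_variable borel (Z n)"
    and int: "\<And>\<eta> n. integrable M (\<lambda>\<omega>. exp (\<eta> * b n * Z n \<omega>))"
    and b: "filterlim b at_top sequentially"
    and lim: "\<And>\<eta>. (\<lambda>n. ln (expectation (\<lambda>\<omega>. exp (\<eta> * b n * Z n \<omega>))) / b n) \<longlonglongrightarrow> \<eta>\<^sup>2 / 2"
    and "c > 0" "\<epsilon> > 0"
  shows "\<forall>\<^sub>F n in sequentially. exp (- b n * (c\<^sup>2 / 2 + \<epsilon>)) \<le> prob {\<omega> \<in> space M. c \<le> Z n \<omega>}"
proof -
  \<comment> \<open>This is the rate with which the proof will end. The moment of order \<theta>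
    contributes \<theta>^2/2 - \<delta>^2/8, absorbing a factor 1/2 costs another \<delta>^2/8, and
    dividing by the maximum of the exponential on the window costs \<theta> (c + 2
    \<delta>).\<close>
  have "((\<lambda>\<delta>. (c + \<delta>)\<^sup>2 / 2 + (c + \<delta>) * \<delta> + \<delta>\<^sup>2 / 4) \<longlongrightarrow> (c + 0)\<^sup>2 / 2 + (c + 0) * 0 + 0\<^sup>2 / 4) (at_right 0)"
    by (intro tendsto_intros) auto
  then have "\<forall>\<^sub>F \<delta> in at_right 0. (c + \<delta>)\<^sup>2 / 2 + (c + \<delta>) * \<delta> + \<delta>\<^sup>2 / 4 < c\<^sup>2 / 2 + \<epsilon>"
    by (rule order_tendstoD) (use \<open>\<epsilon> > 0\<close> in auto)
  moreover have "\<forall>\<^sub>F \<delta> in at_right 0. \<delta> > (0::real)" by (simp add: eventually_at_right_less)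
  ultimately have "\<forall>\<^sub>F \<delta> in at_right 0. \<delta> > 0 \<and> (c + \<delta>)\<^sup>2 / 2 + (c + \<delta>) * \<delta> + \<delta>\<^sup>2 / 4 < c\<^sup>2 / 2 + \<epsilon>"
    by eventually_elim auto
  then obtain \<delta> where \<delta>: "\<delta> > 0" "(c + \<delta>)\<^sup>2 / 2 + (c + \<delta>) * \<delta> + \<delta>\<^sup>2 / 4 < c\<^sup>2 / 2 + \<epsilon>"
    using eventually_happens'[OF trivial_limit_at_right_real] by blast
  define \<theta> where "\<theta> = c + \<delta>"
  let ?E = "\<lambda>\<eta> n. expectation (\<lambda>\<omega>. exp (\<eta> * b n * Z n \<omega>))"
  have pos: "?E \<eta> n > 0" for \<eta> n
  proof -
    have "?E \<eta> n \<noteq> 0"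
      using integral_nonneg_eq_0_iff_AE[OF int[of \<eta> n]] by auto
    moreover have "?E \<eta> n \<ge> 0" by simp
    ultimately show ?thesis by linarith
  qed
  have bpos: "\<forall>\<^sub>F n in sequentially. b n > 0" using b by (simp add: filterlim_at_top_dense)
  \<comment> \<open>Each outer part falls short of the moment of order \<theta> by \<delta>^2/2 in
    the exponent. A slack of \<delta>^2/8 in the upper bounds and again in the lower bound leaves a
    gap of 2 (\<delta>^2/8).\<close>
  have up: "\<forall>\<^sub>F n in sequentially. ?E \<eta> n \<le> exp (b n * (\<eta>\<^sup>2 / 2 + \<delta>\<^sup>2 / 8))" for \<eta>
  proof -
    have "\<forall>\<^sub>F n in sequentially. ln (?E \<eta> n) / b n < \<eta>\<^sup>2 / 2 + \<delta>\<^sup>2 / 8"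
      using lim[of \<eta>] \<delta> by (intro order_tendstoD) auto
    with bpos show ?thesis
    proof eventually_elim
      case (elim n)
      then have "ln (?E \<eta> n) \<le> b n * (\<eta>\<^sup>2 / 2 + \<delta>\<^sup>2 / 8)" by (simp add: divide_less_eq mult_ac)
      then show ?case using pos by (metis exp_le_cancel_iff exp_ln)
    qed
  qed
  have "\<forall>\<^sub>F n in sequentially. ln (?E \<theta> n) / b n > \<theta>\<^sup>2 / 2 - \<delta>\<^sup>2 / 8"
    using lim[of \<theta>] \<delta> by (intro order_tendstoD) auto
  \<comment> \<open>With ln 4 here, the two outer parts together take at most half of
    \<open>?e\<close>, and one more factor exp (-b \<delta>^2/8) makes up for that half.\<close>
  moreover have "\<forall>\<^sub>F n in sequentially. b n * (\<delta>\<^sup>2 / 8) \<ge> ln 4"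
  proof -
    have "filterlim (\<lambda>n. b n * (\<delta>\<^sup>2 / 8)) at_top sequentially"
      using b \<delta> by (intro filterlim_at_top_mult_tendsto_pos[OF tendsto_const]) (auto simp: mult_ac)
    then show ?thesis by (simp add: filterlim_at_top)
  qed
  ultimately show ?thesis using bpos up[of "\<theta> - \<delta>"] up[of "\<theta> + \<delta>"]
  proof eventually_elim
    case (elim n)
    let ?A = "{\<omega> \<in> space M. c \<le> Z n \<omega>}"
    let ?e = "exp (b n * (\<theta>\<^sup>2 / 2 - \<delta>\<^sup>2 / 8))"
    have ie: "integrable M (\<lambda>\<omega>. indicator ?A \<omega> :: real)"
      by (simp add: emeasure_eq_measure)
    have "?e \<le> ?E \<theta> n"
    proof -
      have "b n * (\<theta>\<^sup>2 / 2 - \<delta>\<^sup>2 / 8) \<le> ln (?E \<theta> n)"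
        using elim by (simp add: less_divide_eq mult_ac)
      then show ?thesis using pos by (metis exp_le_cancel_iff exp_ln)
    qed
    \<comment> \<open>Indicators of the outer parts are replaced by exp (b \<delta> (c - Z)) and exp
      (b \<delta> (Z - c - 2 \<delta>)), which are at least 1 there and shift the order of the
      moment by \<delta>.\<close>
    also have "?E \<theta> n \<le> expectation (\<lambda>\<omega>. exp (b n * (\<delta> * c)) * exp ((\<theta> - \<delta>) * b n * Z n \<omega>)
        + exp (- (b n * (\<delta> * (c + 2 * \<delta>)))) * exp ((\<theta> + \<delta>) * b n * Z n \<omega>)
        + exp (b n * (\<theta> * (c + 2 * \<delta>))) * indicator ?A \<omega>)"
    proof (intro integral_mono int Bochner_Integration.integrable_add integrable_mult_right ie)
      fix \<omega> assume \<omega>: "\<omega> \<in> space M"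
      consider "Z n \<omega> < c" | "c \<le> Z n \<omega>" "Z n \<omega> \<le> c + 2 * \<delta>" | "Z n \<omega> > c + 2 * \<delta>" by linarith
      then show "exp (\<theta> * b n * Z n \<omega>) \<le> exp (b n * (\<delta> * c)) * exp ((\<theta> - \<delta>) * b n * Z n \<omega>)
        + exp (- (b n * (\<delta> * (c + 2 * \<delta>)))) * exp ((\<theta> + \<delta>) * b n * Z n \<omega>)
        + exp (b n * (\<theta> * (c + 2 * \<delta>))) * indicator ?A \<omega>" (is "_ \<le> ?a + ?b + ?c")
      proof cases
        case 1
        have "b n * \<delta> * Z n \<omega> \<le> b n * \<delta> * c" using 1 elim \<delta> by (intro mult_left_mono) auto
        then have "exp (\<theta> * b n * Z n \<omega>) \<le> ?a" by (simp flip: exp_add) (simp add: algebra_simps)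
        moreover have "?b \<ge> 0" "?c \<ge> 0" by auto
        ultimately show ?thesis by linarith
      next
        case 2
        have "b n * \<theta> * Z n \<omega> \<le> b n * \<theta> * (c + 2 * \<delta>)"
          using 2 elim \<delta> \<open>c > 0\<close> by (intro mult_left_mono) (auto simp: \<theta>_def)
        then have "exp (\<theta> * b n * Z n \<omega>) \<le> ?c" using 2 \<omega> by (simp add: mult_ac)
        moreover have "?b \<ge> 0" "?a \<ge> 0" by auto
        ultimately show ?thesis by linarith
      next
        case 3
        have "b n * \<delta> * (c + 2 * \<delta>) \<le> b n * \<delta> * Z n \<omega>" using 3 elim \<delta> by (intro mult_left_mono) auto
        then have "exp (\<theta> * b n * Z n \<omega>) \<le> ?b" by (simp flip: exp_add) (simp add: algebra_simps)
        moreover have "?a \<ge> 0" "?c \<ge> 0" by auto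
        ultimately show ?thesis by linarith
      qed
    qed
    also have "\<dots> = exp (b n * (\<delta> * c)) * ?E (\<theta> - \<delta>) n
        + exp (- (b n * (\<delta> * (c + 2 * \<delta>)))) * ?E (\<theta> + \<delta>) n
        + exp (b n * (\<theta> * (c + 2 * \<delta>))) * prob ?A"
      using int ie by (subst Bochner_Integration.integral_add;
        (intro Bochner_Integration.integrable_add integrable_mult_right int ie)?)+ simp
    also have "\<dots> \<le> exp (b n * (\<delta> * c)) * exp (b n * ((\<theta> - \<delta>)\<^sup>2 / 2 + \<delta>\<^sup>2 / 8))
        + exp (- (b n * (\<delta> * (c + 2 * \<delta>)))) * exp (b n * ((\<theta> + \<delta>)\<^sup>2 / 2 + \<delta>\<^sup>2 / 8))
        + exp (b n * (\<theta> * (c + 2 * \<delta>))) * prob ?A"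
      using elim by (intro add_mono mult_left_mono) auto
    also have "exp (b n * (\<delta> * c)) * exp (b n * ((\<theta> - \<delta>)\<^sup>2 / 2 + \<delta>\<^sup>2 / 8))
        = ?e * exp (- (2 * (b n * (\<delta>\<^sup>2 / 8))))"
      by (simp flip: exp_add) (simp add: \<theta>_def power2_eq_square field_simps)
    also have "exp (- (b n * (\<delta> * (c + 2 * \<delta>)))) * exp (b n * ((\<theta> + \<delta>)\<^sup>2 / 2 + \<delta>\<^sup>2 / 8))
        = ?e * exp (- (2 * (b n * (\<delta>\<^sup>2 / 8))))"
      by (simp flip: exp_add) (simp add: \<theta>_def power2_eq_square field_simps)
    finally have 1: "?e \<le> 2 * (?e * exp (- (2 * (b n * (\<delta>\<^sup>2 / 8)))))
        + exp (b n * (\<theta> * (c + 2 * \<delta>))) * prob ?A" by linarith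
    have small: "exp (- (b n * (\<delta>\<^sup>2 / 8))) \<le> 1 / 4"
    proof -
      have "exp (- (b n * (\<delta>\<^sup>2 / 8))) \<le> exp (- ln 4)" using elim by simp
      then show ?thesis by (simp add: exp_minus)
    qed
    have "exp (- (2 * (b n * (\<delta>\<^sup>2 / 8)))) \<le> 1 / 4"
    proof -
      have "exp (- (2 * (b n * (\<delta>\<^sup>2 / 8)))) \<le> exp (- (b n * (\<delta>\<^sup>2 / 8)))" using elim by simp
      then show ?thesis using small by linarith
    qed
    then have "2 * (?e * exp (- (2 * (b n * (\<delta>\<^sup>2 / 8))))) \<le> 2 * (?e * (1 / 4))"
      by (intro mult_left_mono) auto
    with 1 have "?e / 2 \<le> exp (b n * (\<theta> * (c + 2 * \<delta>))) * prob ?A" by linarith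
    moreover have "?e * exp (- (b n * (\<delta>\<^sup>2 / 8))) \<le> ?e * (1 / 4)"
      using small by (intro mult_left_mono) auto
    moreover have "?e > 0" by simp
    ultimately have "?e * exp (- (b n * (\<delta>\<^sup>2 / 8))) \<le> exp (b n * (\<theta> * (c + 2 * \<delta>))) * prob ?A"
      by linarith
    then have "?e * exp (- (b n * (\<delta>\<^sup>2 / 8))) * exp (- (b n * (\<theta> * (c + 2 * \<delta>)))) \<le> prob ?A"
      by (subst exp_minus, subst divide_inverse[symmetric]) (simp add: pos_divide_le_eq mult.commute)
    moreover have "exp (- b n * (c\<^sup>2 / 2 + \<epsilon>))
        \<le> ?e * exp (- (b n * (\<delta>\<^sup>2 / 8))) * exp (- (b n * (\<theta> * (c + 2 * \<delta>))))"
    proof -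
      have "b n * ((c + \<delta>)\<^sup>2 / 2 + (c + \<delta>) * \<delta> + \<delta>\<^sup>2 / 4) \<le> b n * (c\<^sup>2 / 2 + \<epsilon>)"
        using \<delta>(2) elim by (intro mult_left_mono) auto
      then show ?thesis
        by (simp flip: exp_add) (simp add: \<theta>_def power2_eq_square field_simps)
    qed
    ultimately show ?case by linarith
  qed
qed

section \<open>Limiting cumulant function of the kernel estimator\<close>

text \<open>The bias term is controlled by \<open>(n s h\<^sup>3 / b)\<^sup>2 = (n s\<^sup>2 h / b) (n h\<^sup>5 / b)\<close>.\<close>

lemma centred_log_mgf_tendsto:
  fixes h b m1 m2 s L :: "nat \<Rightarrow> real"
  assumes pos: "\<forall>\<^sub>F n in sequentially. h n > 0" "\<forall>\<^sub>F n in sequentially. b n > 0"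
    and h: "h \<longlonglongrightarrow> 0" and s: "s \<longlonglongrightarrow> 0"
    and c: "\<forall>\<^sub>F n in sequentially. real n * (s n)\<^sup>2 * h n / b n = c"
    and h5: "(\<lambda>n. real n * h n ^ 5 / b n) \<longlonglongrightarrow> 0"
    and m1: "\<forall>\<^sub>F n in sequentially. \<bar>m1 n / h n - F\<bar> \<le> C * (h n)\<^sup>2"
    and m2: "(\<lambda>n. m2 n / h n) \<longlonglongrightarrow> V"
    and L: "\<forall>\<^sub>F n in sequentially. \<bar>L n - s n * m1 n - (s n)\<^sup>2 / 2 * m2 n\<bar>
              \<le> \<bar>s n\<bar> ^ 3 * B * m2 n + 18 * (s n)\<^sup>2 * (m1 n)\<^sup>2"
  shows "(\<lambda>n. real n * (L n - s n * h n * F) / b n) \<longlonglongrightarrow> c * V / 2"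
proof -
  have m1F: "(\<lambda>n. m1 n / h n) \<longlonglongrightarrow> F"
  proof -
    have "(\<lambda>n. C * (h n)\<^sup>2) \<longlonglongrightarrow> C * 0\<^sup>2" by (intro tendsto_intros h)
    then have "(\<lambda>n. C * (h n)\<^sup>2) \<longlonglongrightarrow> 0" by simp
    then have "(\<lambda>n. m1 n / h n - F) \<longlonglongrightarrow> 0"
      by (rule Lim_null_comparison[rotated]) (use m1 in simp)
    then show ?thesis by (rule LIM_zero_cancel)
  qed
  \<comment> \<open>\<open>D\<close> is the deviation from the surviving second-order term. The
    three terms of \<open>R\<close> bound the bias, the cubic remainder and the squared
    mean.\<close>
  define D where "D n = real n * (L n - s n * h n * F) / b n - c / 2 * (m2 n / h n)" for n
  define R where "R n = C * sqrt (c * (real n * h n ^ 5 / b n))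
      + c * (\<bar>s n\<bar> * B * (m2 n / h n) + 18 * h n * (m1 n / h n)\<^sup>2)" for n
  have "\<forall>\<^sub>F n in sequentially. norm (D n) \<le> R n"
    using pos c m1 L
  proof eventually_elim
    case (elim n)
    have c0: "c \<ge> 0" using elim(1,2) unfolding elim(3)[symmetric] by simp
    have C0: "C * (h n)\<^sup>2 \<ge> 0" using elim(4) abs_ge_zero order_trans by blast
    \<comment> \<open>The prefactor n s^2 / b is of order 1/h: \<open>m2\<close>, of order h,
      survives it, while the square of \<open>m1\<close> contributes only order h.\<close>
    have ns: "real n * (s n)\<^sup>2 / b n = c / h n" using elim by (simp add: field_simps)
    have "D n = real n / b n * (s n * h n) * (m1 n / h n - F)
        + real n / b n * (L n - s n * m1 n - (s n)\<^sup>2 / 2 * m2 n)"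
    proof -
      have "c / 2 * (m2 n / h n) = real n * (s n)\<^sup>2 / b n / 2 * m2 n" unfolding ns by simp
      moreover have "(s n * h n) * (m1 n / h n - F) = s n * m1 n - s n * h n * F"
        using elim(1) by (simp add: right_diff_distrib)
      ultimately show ?thesis
        unfolding D_def mult.assoc by (simp add: right_diff_distrib diff_divide_distrib mult_ac)
    qed
    then have "\<bar>D n\<bar> \<le> \<bar>real n / b n * (s n * h n) * (m1 n / h n - F)\<bar>
        + \<bar>real n / b n * (L n - s n * m1 n - (s n)\<^sup>2 / 2 * m2 n)\<bar>" by (simp only: abs_triangle_ineq)
    also have "\<bar>real n / b n * (s n * h n) * (m1 n / h n - F)\<bar>
        = real n / b n * \<bar>s n\<bar> * h n * \<bar>m1 n / h n - F\<bar>"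
      using elim by (simp add: abs_mult)
    also have "\<dots> \<le> real n / b n * \<bar>s n\<bar> * h n * (C * (h n)\<^sup>2)"
      using elim by (intro mult_left_mono) auto
    also have "\<dots> = C * (real n / b n * \<bar>s n\<bar> * h n ^ 3)"
      by (simp add: power2_eq_square power3_eq_cube)
    also have "real n / b n * \<bar>s n\<bar> * h n ^ 3 = sqrt ((real n / b n * \<bar>s n\<bar> * h n ^ 3)\<^sup>2)"
      using elim by simp
    also have "(real n / b n * \<bar>s n\<bar> * h n ^ 3)\<^sup>2
        = real n * (s n)\<^sup>2 * h n / b n * (real n * h n ^ 5 / b n)"
    proof -
      have "(h n ^ 3)\<^sup>2 = h n * h n ^ 5" by (simp flip: power_mult power_Suc)
      then show ?thesis by (simp add: power_mult_distrib power_divide power2_eq_square[of "b n"]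
          power2_eq_square[of "real n"])
    qed
    also have "real n * (s n)\<^sup>2 * h n / b n = c" by (fact elim(3))
    also have "\<bar>real n / b n * (L n - s n * m1 n - (s n)\<^sup>2 / 2 * m2 n)\<bar>
        = real n / b n * \<bar>L n - s n * m1 n - (s n)\<^sup>2 / 2 * m2 n\<bar>"
      using elim by (simp add: abs_mult)
    also have "\<dots> \<le> real n / b n * (\<bar>s n\<bar> ^ 3 * B * m2 n + 18 * (s n)\<^sup>2 * (m1 n)\<^sup>2)"
      using elim by (intro mult_left_mono) auto
    also have "\<dots> = real n * (s n)\<^sup>2 / b n * (\<bar>s n\<bar> * B * m2 n + 18 * (m1 n)\<^sup>2)"
    proof -
      have "\<bar>s n\<bar> ^ 3 = (s n)\<^sup>2 * \<bar>s n\<bar>" by (simp add: power3_eq_cube power2_eq_square)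
      then show ?thesis by (simp add: algebra_simps)
    qed
    also have "\<dots> = c * (\<bar>s n\<bar> * B * (m2 n / h n) + 18 * h n * (m1 n / h n)\<^sup>2)"
      unfolding ns using elim(1) by (simp add: field_simps power2_eq_square)
    finally show ?case unfolding R_def by simp
  qed
  moreover have "R \<longlonglongrightarrow> 0"
  proof -
    have "R \<longlonglongrightarrow> C * sqrt (c * 0) + c * (\<bar>0\<bar> * B * V + 18 * 0 * F\<^sup>2)"
      unfolding R_def by (intro tendsto_intros h s h5 m1F m2)
    then show ?thesis by simp
  qed
  ultimately have "D \<longlonglongrightarrow> 0" by (rule Lim_null_comparison)
  then have "(\<lambda>n. D n + c / 2 * (m2 n / h n)) \<longlonglongrightarrow> 0 + c / 2 * V" by (intro tendsto_intros m2)
  then show ?thesis by (simp add: D_def)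
qed

lemma (in prob_space) expectation_exp_sum_iid:
  fixes X :: "nat \<Rightarrow> 'a \<Rightarrow> real" and g :: "real \<Rightarrow> real"
  assumes indep: "indep_vars (\<lambda>_. borel) X {1..}"
    and dist: "\<And>j. j \<ge> 1 \<Longrightarrow> distributed M lborel (X j) p"
    and g[measurable]: "g \<in> borel_measurable borel" and B: "\<And>t. \<bar>g t\<bar> \<le> B"
  shows "expectation (\<lambda>\<omega>. exp (\<Sum>j = 1..n. g (X j \<omega>))) = expectation (\<lambda>\<omega>. exp (g (X 1 \<omega>))) ^ n"
proof -
  have X[measurable]: "random_variable borel (X j)" if "j \<ge> 1" for j
    using distributed_measurable[OF dist[OF that]] by simp
  have int: "integrable M (\<lambda>\<omega>. exp (g (X j \<omega>)))" if "j \<ge> 1" for j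
  proof (rule integrable_const_bound[where B = "exp B"])
    show "AE \<omega> in M. norm (exp (g (X j \<omega>))) \<le> exp B" using B by (auto simp: abs_le_iff)
    show "(\<lambda>\<omega>. exp (g (X j \<omega>))) \<in> borel_measurable M" using X[OF that] by measurable
  qed
  have "indep_vars (\<lambda>_. borel) (\<lambda>j \<omega>. exp (g (X j \<omega>))) {1..n}"
    by (rule indep_vars_compose2[where M' = "\<lambda>_. borel", OF indep_vars_subset[OF indep]]) auto
  then have "expectation (\<lambda>\<omega>. \<Prod>j\<in>{1..n}. exp (g (X j \<omega>)))
      = (\<Prod>j\<in>{1..n}. expectation (\<lambda>\<omega>. exp (g (X j \<omega>))))"
    by (intro indep_vars_lebesgue_integral int) auto
  also have "\<dots> = (\<Prod>j\<in>{1..n}. expectation (\<lambda>\<omega>. exp (g (X 1 \<omega>))))"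
  proof (intro prod.cong refl)
    fix j assume j: "j \<in> {1..n}"
    have "distr M lborel (X j) = distr M lborel (X 1)"
      using dist[of j] dist[of 1] j by (simp add: distributed_distr_eq_density)
    then have "integral\<^sup>L (distr M lborel (X j)) (\<lambda>t. exp (g t))
             = integral\<^sup>L (distr M lborel (X 1)) (\<lambda>t. exp (g t))" by simp
    then show "expectation (\<lambda>\<omega>. exp (g (X j \<omega>))) = expectation (\<lambda>\<omega>. exp (g (X 1 \<omega>)))"
      using X[of j] X[of 1] j by (simp add: integral_distr)
  qed
  finally show ?thesis by (simp add: exp_sum)
qed

text \<open>The exponent is a sum of n independent terms s (K((x - X_j)/h) - h f(x)), so its log
  moment generating function is n times that of one term. The limit is c V / 2 with c = \<eta>^2 /
  (\<kappa> f(x)) and V = \<kappa> f(x).\<close>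

lemma (in prob_space) kernel_density_log_mgf_tendsto:
  fixes X :: "nat \<Rightarrow> 'a \<Rightarrow> real" and f K :: "real \<Rightarrow> real" and h b :: "nat \<Rightarrow> real"
  assumes indep: "indep_vars (\<lambda>_. borel) X {1..}"
    and dist: "\<And>j. j \<ge> 1 \<Longrightarrow> distributed M lborel (X j) (\<lambda>x. ennreal (f x))"
    and f0: "\<And>x. 0 \<le> f x" and fb: "bounded (range f)"
    and fx: "f x > 0" "twice_differentiable_at f x"
    and K0: "\<And>t. 0 \<le> K t" and Kb: "\<And>t. K t \<le> B"
    and K: "has_bochner_integral lborel K 1" and K1: "has_bochner_integral lborel (\<lambda>t. t * K t) 0"
    and K2: "integrable lborel (\<lambda>t. t\<^sup>2 * K t)"
    and \<kappa>: "\<kappa> = (\<integral>t. (K t)\<^sup>2 \<partial>lborel)" "\<kappa> > 0"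
    and pos: "\<And>n. n \<ge> 2 \<Longrightarrow> h n > 0" "\<And>n. n \<ge> 2 \<Longrightarrow> b n > 0"
    and h: "h \<longlonglongrightarrow> 0" and h5: "(\<lambda>n. real n * h n ^ 5 / b n) \<longlonglongrightarrow> 0"
    and bn: "(\<lambda>n. b n / (real n * h n)) \<longlonglongrightarrow> 0"
  defines "q \<equiv> \<lambda>n. sqrt (\<kappa> * f x * b n / (real n * h n))"
  shows "(\<lambda>n. ln (expectation (\<lambda>\<omega>. exp (\<eta> * b n *
           ((kernel_density_estimator K h X n x \<omega> - f x) / q n)))) / b n) \<longlonglongrightarrow> \<eta>\<^sup>2 / 2"
proof -
  have iK: "integrable lborel K" "(\<integral>t. K t \<partial>lborel) = 1"
    and iK1: "integrable lborel (\<lambda>t. t * K t)" "(\<integral>t. t * K t \<partial>lborel) = 0"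
    using K K1 by (auto simp: has_bochner_integral_iff)
  have [measurable]: "K \<in> borel_measurable borel" using borel_measurable_integrable[OF iK(1)] by simp
  have B0: "B \<ge> 0" using K0 Kb order_trans by blast
  \<comment> \<open>K^2 \<le> B K transfers integrability to the three moments of K^2, with
    \<open>g\<close> equal to 1, t and t^2.\<close>
  have iKK: "integrable lborel (\<lambda>t. g t * (K t)\<^sup>2)"
    if "integrable lborel (\<lambda>t. g t * K t)" and [measurable]: "g \<in> borel_measurable borel" for g
  proof (rule Bochner_Integration.integrable_bound)
    show "integrable lborel (\<lambda>t. B * (g t * K t))" using that by simp
    show "AE t in lborel. norm (g t * (K t)\<^sup>2) \<le> norm (B * (g t * K t))"
    proof (rule AE_I2)
      fix t
      have "\<bar>g t\<bar> * K t * K t \<le> \<bar>g t\<bar> * K t * B" using K0 Kb by (intro mult_left_mono) auto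
      then show "norm (g t * (K t)\<^sup>2) \<le> norm (B * (g t * K t))"
        using K0[of t] B0 by (simp add: abs_mult power2_eq_square mult_ac)
    qed
  qed measurable
  obtain A where A: "\<And>t. \<bar>f (x + t) - f x - deriv f x * t\<bar> \<le> A * t\<^sup>2"
    using twice_differentiable_at_quadratic_remainder[OF fx(2) fb] by blast
  define Y where "Y n \<omega> = K ((x - X 1 \<omega>) / h n)" for n \<omega>
  define m1 where "m1 n = expectation (Y n)" for n
  define m2 where "m2 n = expectation (\<lambda>\<omega>. (Y n \<omega>)\<^sup>2)" for n
  \<comment> \<open>Chosen so that \<open>\<eta> * b n / q n = s n * (real n * h n)\<close>, which
    cancels the normalisation of the estimator.\<close>
  define s where "s n = \<eta> * q n / (\<kappa> * f x)" for n
  have Y[measurable]: "random_variable borel (Y n)" for n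
    using distributed_measurable[OF dist[of 1]] unfolding Y_def by simp
  have ev: "\<forall>\<^sub>F n in sequentially. n \<ge> (2::nat)" by (rule eventually_ge_at_top)
  have q0: "q \<longlonglongrightarrow> 0"
  proof -
    have "q \<longlonglongrightarrow> sqrt (\<kappa> * f x * 0)"
      unfolding q_def times_divide_eq_right[symmetric] by (intro tendsto_intros bn)
    then show ?thesis by simp
  qed
  have s0: "s \<longlonglongrightarrow> 0"
  proof -
    have "s \<longlonglongrightarrow> \<eta> * 0 / (\<kappa> * f x)" unfolding s_def using \<kappa> fx by (intro tendsto_intros q0) auto
    then show ?thesis by simp
  qed
  have q2: "(q n)\<^sup>2 = \<kappa> * f x * b n / (real n * h n)" "q n > 0" if "n \<ge> 2" for n
    using \<kappa> fx pos[OF that] that by (auto simp: q_def)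
  have "(\<lambda>n. real n * (ln (expectation (\<lambda>\<omega>. exp (s n * Y n \<omega>))) - s n * h n * f x) / b n)
      \<longlonglongrightarrow> \<eta>\<^sup>2 / (\<kappa> * f x) * (f x * \<kappa>) / 2"
  proof (rule centred_log_mgf_tendsto[where ?m1.0 = m1 and ?m2.0 = m2])
    show "\<forall>\<^sub>F n in sequentially. h n > 0" "\<forall>\<^sub>F n in sequentially. b n > 0"
      using ev by (eventually_elim, simp add: pos)+
    show "\<forall>\<^sub>F n in sequentially. real n * (s n)\<^sup>2 * h n / b n = \<eta>\<^sup>2 / (\<kappa> * f x)"
      using ev
    proof eventually_elim
      case (elim n)
      then show ?case using pos[OF elim] \<kappa> fx
        by (simp add: s_def power_divide power_mult_distrib q2) (simp add: field_simps power2_eq_square)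
    qed
    show "\<forall>\<^sub>F n in sequentially. \<bar>m1 n / h n - f x\<bar> \<le> (A * (\<integral>t. t\<^sup>2 * K t \<partial>lborel)) * (h n)\<^sup>2"
      using ev
    proof eventually_elim
      case (elim n)
      show ?case
        using expectation_kernel_expansion[OF dist f0 fb A K0 iK(1) iK1(1) K2 pos(1)[OF elim], of 1]
        by (simp add: iK iK1 m1_def Y_def[abs_def] mult_ac)
    qed
    show "(\<lambda>n. m2 n / h n) \<longlonglongrightarrow> f x * \<kappa>"
    proof -
      let ?d = "\<lambda>n. deriv f x * h n * (\<integral>t. t * (K t)\<^sup>2 \<partial>lborel)"
      let ?r = "\<lambda>n. A * (h n)\<^sup>2 * (\<integral>t. t\<^sup>2 * (K t)\<^sup>2 \<partial>lborel)"
      have "\<forall>\<^sub>F n in sequentially. norm (m2 n / h n - (f x * \<kappa> - ?d n)) \<le> ?r n"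
        using ev
      proof eventually_elim
        case (elim n)
        show ?case
          using expectation_kernel_expansion[OF dist f0 fb A _ _ _ _ pos(1)[OF elim],
              of 1 "\<lambda>t. (K t)\<^sup>2"] iKK[of "\<lambda>_. 1"] iKK[of "\<lambda>t. t"] iKK[of "\<lambda>t. t\<^sup>2"] iK iK1 K2
          by (simp add: \<kappa> m2_def Y_def)
      qed
      moreover have "?r \<longlonglongrightarrow> A * 0\<^sup>2 * (\<integral>t. t\<^sup>2 * (K t)\<^sup>2 \<partial>lborel)" by (intro tendsto_intros h)
      then have "?r \<longlonglongrightarrow> 0" by simp
      ultimately have "(\<lambda>n. m2 n / h n - (f x * \<kappa> - ?d n)) \<longlonglongrightarrow> 0"
        by (rule Lim_null_comparison)
      moreover have "(\<lambda>n. f x * \<kappa> - ?d n) \<longlonglongrightarrow> f x * \<kappa> - deriv f x * 0 * (\<integral>t. t * (K t)\<^sup>2 \<partial>lborel)"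
        by (intro tendsto_intros h)
      ultimately have "(\<lambda>n. (m2 n / h n - (f x * \<kappa> - ?d n)) + (f x * \<kappa> - ?d n))
          \<longlonglongrightarrow> 0 + (f x * \<kappa> - deriv f x * 0 * (\<integral>t. t * (K t)\<^sup>2 \<partial>lborel))" by (rule tendsto_add)
      then show ?thesis by simp
    qed
    have "(\<lambda>n. 6 * \<bar>s n\<bar> * B) \<longlonglongrightarrow> 6 * \<bar>0\<bar> * B" by (intro tendsto_intros s0)
    then have "\<forall>\<^sub>F n in sequentially. 6 * \<bar>s n\<bar> * B < 1" by (rule order_tendstoD) auto
    then show "\<forall>\<^sub>F n in sequentially. \<bar>ln (expectation (\<lambda>\<omega>. exp (s n * Y n \<omega>))) - s n * m1 n - (s n)\<^sup>2 / 2 * m2 n\<bar>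
        \<le> \<bar>s n\<bar> ^ 3 * B * m2 n + 18 * (s n)\<^sup>2 * (m1 n)\<^sup>2"
    proof eventually_elim
      case (elim n)
      show ?case unfolding m1_def m2_def
        by (rule ln_mgf_quadratic_expansion[OF Y]) (use elim K0 Kb in \<open>auto simp: Y_def\<close>)
    qed
  qed (fact h s0 h5)+
  moreover have "\<eta>\<^sup>2 / (\<kappa> * f x) * (f x * \<kappa>) / 2 = \<eta>\<^sup>2 / 2" using \<kappa> fx by simp
  ultimately have "(\<lambda>n. real n * (ln (expectation (\<lambda>\<omega>. exp (s n * Y n \<omega>))) - s n * h n * f x) / b n)
      \<longlonglongrightarrow> \<eta>\<^sup>2 / 2" by simp
  then show ?thesis
  proof (rule Lim_transform_eventually)
    show "\<forall>\<^sub>F n in sequentially.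
      real n * (ln (expectation (\<lambda>\<omega>. exp (s n * Y n \<omega>))) - s n * h n * f x) / b n
      = ln (expectation (\<lambda>\<omega>. exp (\<eta> * b n * ((kernel_density_estimator K h X n x \<omega> - f x) / q n)))) / b n"
      using ev
    proof eventually_elim
      case (elim n)
      note p = pos[OF elim] q2[OF elim]
      let ?E = "expectation (\<lambda>\<omega>. exp (s n * Y n \<omega>))"
      have sn: "\<eta> * b n / q n = s n * (real n * h n)"
      proof -
        have "\<eta> * b n * (\<kappa> * f x) = \<eta> * (q n)\<^sup>2 * (real n * h n)" using p elim by simp
        then show ?thesis using p \<kappa> fx by (simp add: s_def field_simps power2_eq_square)
      qed
      have E: "exp (\<eta> * b n * ((kernel_density_estimator K h X n x \<omega> - f x) / q n))
          = exp (- (s n * (real n * h n) * f x)) * exp (\<Sum>j = 1..n. s n * K ((x - X j \<omega>) / h n))" for \<omega>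
      proof -
        let ?S = "\<Sum>j = 1..n. K ((x - X j \<omega>) / h n)"
        have "\<eta> * b n * ((kernel_density_estimator K h X n x \<omega> - f x) / q n)
            = \<eta> * b n / q n * (?S / (real n * h n) - f x)"
          by (simp add: kernel_density_estimator_def)
        also have "\<dots> = s n * ?S - s n * (real n * h n) * f x"
          unfolding sn using p elim by (simp add: field_simps)
        finally show ?thesis by (simp add: sum_distrib_left flip: exp_add)
      qed
      have "\<bar>s n * K ((x - t) / h n)\<bar> \<le> \<bar>s n\<bar> * B" for t
        using K0 Kb by (auto simp: abs_mult intro!: mult_left_mono)
      then have P: "expectation (\<lambda>\<omega>. exp (\<Sum>j = 1..n. s n * K ((x - X j \<omega>) / h n))) = ?E ^ n"
        using expectation_exp_sum_iid[OF indep dist, of "\<lambda>t. s n * K ((x - t) / h n)" "\<bar>s n\<bar> * B" n]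
        by (simp add: Y_def)
      have "?E > 0"
      proof -
        have "integrable M (\<lambda>\<omega>. exp (s n * Y n \<omega>))"
        proof (rule integrable_const_bound[where B = "exp (\<bar>s n\<bar> * B)"])
          have "s n * Y n \<omega> \<le> \<bar>s n\<bar> * B" for \<omega>
            using K0 Kb by (auto simp: Y_def intro!: mult_mono)
          then show "AE \<omega> in M. norm (exp (s n * Y n \<omega>)) \<le> exp (\<bar>s n\<bar> * B)" by simp
        qed measurable
        then have "?E \<noteq> 0" by (subst integral_nonneg_eq_0_iff_AE) auto
        moreover have "?E \<ge> 0" by simp
        ultimately show ?thesis by linarith
      qed
      then show ?case unfolding E integral_mult_right_zero P
        by (simp add: ln_mult ln_realpow algebra_simps)
    qed
  qed
qed

section \<open>Logarithmic rate of events sandwiched between tails\<close>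

text \<open>From below a single tail suffices, since both tails have the same rate. From above both
  are added, the left one by applying the upper bound to -Z, as \<eta>^2/2 is even; the resulting
  factor 2 disappears on the scale \<open>b\<close>.\<close>

lemma (in prob_space) gaussian_two_sided_log_rate:
  fixes Z :: "nat \<Rightarrow> 'a \<Rightarrow> real"
  assumes Z[measurable]: "\<And>n. random_variable borel (Z n)"
    and int: "\<And>\<eta> n. integrable M (\<lambda>\<omega>. exp (\<eta> * b n * Z n \<omega>))"
    and b: "filterlim b at_top sequentially"
    and lim: "\<And>\<eta>. (\<lambda>n. ln (expectation (\<lambda>\<omega>. exp (\<eta> * b n * Z n \<omega>))) / b n) \<longlonglongrightarrow> \<eta>\<^sup>2 / 2"
    and r: "r > 0"
    and meas: "\<forall>\<^sub>F n in sequentially. E n \<in> events"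
    and inner: "\<And>c. c > r \<Longrightarrow> \<forall>\<^sub>F n in sequentially. {\<omega> \<in> space M. c \<le> Z n \<omega>} \<subseteq> E n"
    and outer: "\<And>c. 0 < c \<Longrightarrow> c < r \<Longrightarrow> \<forall>\<^sub>F n in sequentially. E n \<subseteq> {\<omega> \<in> space M. c \<le> \<bar>Z n \<omega>\<bar>}"
  shows "(\<lambda>n. ln (prob (E n)) / b n) \<longlonglongrightarrow> - (r\<^sup>2 / 2)"
proof (rule order_tendstoI)
  have bpos: "\<forall>\<^sub>F n in sequentially. b n > 0" using b by (simp add: filterlim_at_top_dense)
  have low: "\<forall>\<^sub>F n in sequentially. exp (- b n * (c\<^sup>2 / 2 + \<epsilon>)) \<le> prob (E n)" if "c > r" "\<epsilon> > 0" for c \<epsilon>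
  proof -
    have "c > 0" using that r by simp
    from gaussian_ldp_lower[OF Z int b lim this that(2)] inner[OF that(1)] meas
    show ?thesis
    proof eventually_elim
      case (elim n)
      then show ?case using finite_measure_mono[of "{\<omega> \<in> space M. c \<le> Z n \<omega>}" "E n"] by simp
    qed
  qed
  fix y :: real
  show "\<forall>\<^sub>F n in sequentially. y < ln (prob (E n)) / b n" if y: "y < - (r\<^sup>2 / 2)"
  proof -
    \<comment> \<open>One \<epsilon> goes into c^2/2 = r^2/2 + \<epsilon> and one into the tail
      bound; the rate r^2/2 + 2 \<epsilon> stays below -y = r^2/2 + 4 \<epsilon>.\<close>
    define \<epsilon> where "\<epsilon> = (- (r\<^sup>2 / 2) - y) / 4"
    have \<epsilon>: "\<epsilon> > 0" using y by (simp add: \<epsilon>_def)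
    have c: "sqrt (r\<^sup>2 + 2 * \<epsilon>) > r" using \<epsilon> r by (intro real_less_rsqrt) auto
    show ?thesis using low[OF c \<epsilon>] bpos
    proof eventually_elim
      case (elim n)
      have "y = - (r\<^sup>2 / 2) - 4 * \<epsilon>" by (simp add: \<epsilon>_def field_simps)
      then have "(sqrt (r\<^sup>2 + 2 * \<epsilon>))\<^sup>2 / 2 + \<epsilon> < - y" using \<epsilon> by simp
      then have "b n * ((sqrt (r\<^sup>2 + 2 * \<epsilon>))\<^sup>2 / 2 + \<epsilon>) < b n * (- y)"
        using elim(2) by (intro mult_strict_left_mono)
      then have "exp (b n * y) < prob (E n)" using elim(1) by (intro less_le_trans[OF _ elim(1)]) simp
      then have "ln (exp (b n * y)) < ln (prob (E n))" by (subst ln_less_cancel_iff) (auto intro: less_trans[OF exp_gt_zero])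
      then show ?case using elim(2) by (simp add: less_divide_eq mult.commute)
    qed
  qed
  show "\<forall>\<^sub>F n in sequentially. ln (prob (E n)) / b n < y" if y: "y > - (r\<^sup>2 / 2)"
  proof -
    \<comment> \<open>The minimum with r^2/4 keeps r^2 - 2 \<epsilon> positive. The choice of c, the
      tail bound and the factor 2 cost one \<epsilon> each.\<close>
    define \<epsilon> where "\<epsilon> = min ((y + r\<^sup>2 / 2) / 4) (r\<^sup>2 / 4)"
    have \<epsilon>: "\<epsilon> > 0" "4 * \<epsilon> \<le> r\<^sup>2" "4 * \<epsilon> \<le> y + r\<^sup>2 / 2" using y r by (auto simp: \<epsilon>_def min_def)
    define c where "c = sqrt (r\<^sup>2 - 2 * \<epsilon>)"
    have c: "c > 0" "c < r" "c\<^sup>2 = r\<^sup>2 - 2 * \<epsilon>"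
      using \<epsilon> r real_sqrt_less_mono[of "r\<^sup>2 - 2 * \<epsilon>" "r\<^sup>2"] by (auto simp: c_def)
    have neg: "\<forall>\<^sub>F n in sequentially. prob {\<omega> \<in> space M. c \<le> - Z n \<omega>} \<le> exp (- b n * (c\<^sup>2 / 2 - \<epsilon>))"
    proof (rule gaussian_ldp_upper[where Z = "\<lambda>n \<omega>. - Z n \<omega>"])
      fix \<eta> n
      show "integrable M (\<lambda>\<omega>. exp (\<eta> * b n * - Z n \<omega>))" using int[of "-\<eta>"] by simp
      show "(\<lambda>n. ln (expectation (\<lambda>\<omega>. exp (\<eta> * b n * - Z n \<omega>))) / b n) \<longlonglongrightarrow> \<eta>\<^sup>2 / 2"
        using lim[of "-\<eta>"] by simp
    qed (use b c \<epsilon> in auto)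
    have "\<forall>\<^sub>F n in sequentially. b n > ln 2 / \<epsilon>" using b by (simp add: filterlim_at_top_dense)
    then show ?thesis
      using low[of "r + 1" 1, simplified] bpos neg meas
        gaussian_ldp_upper[OF Z int b lim c(1) \<epsilon>(1)] outer[OF c(1,2)]
    proof eventually_elim
      case (elim n)
      \<comment> \<open>The bound \<open>low\<close> serves only to make the probability positive,
        so that \<open>ln\<close> is monotone here and does not take its default value at 0.\<close>
      have P: "prob (E n) > 0" using elim(2) by (rule less_le_trans[OF exp_gt_zero])
      have "prob (E n) \<le> prob ({\<omega> \<in> space M. c \<le> Z n \<omega>} \<union> {\<omega> \<in> space M. c \<le> - Z n \<omega>})"
        using elim(7) by (intro finite_measure_mono) (auto simp: abs_if split: if_splits)
      also have "\<dots> \<le> prob {\<omega> \<in> space M. c \<le> Z n \<omega>} + prob {\<omega> \<in> space M. c \<le> - Z n \<omega>}"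
        by (rule measure_Un_le) auto
      also have "\<dots> \<le> 2 * exp (- b n * (c\<^sup>2 / 2 - \<epsilon>))" using elim(4,6) by simp
      finally have "ln (prob (E n)) \<le> ln (2 * exp (- b n * (c\<^sup>2 / 2 - \<epsilon>)))" using P by (subst ln_le_cancel_iff) auto
      also have "\<dots> = ln 2 - b n * (r\<^sup>2 / 2 - 2 * \<epsilon>)" by (simp add: ln_mult c(3) field_simps)
      also have "\<dots> < b n * \<epsilon> - b n * (r\<^sup>2 / 2 - 2 * \<epsilon>)" using elim(1) \<epsilon> by (simp add: divide_less_eq)
      also have "\<dots> = b n * (3 * \<epsilon> - r\<^sup>2 / 2)" by (simp add: algebra_simps)
      also have "\<dots> \<le> b n * y" using \<epsilon> elim(3) by (intro mult_left_mono) auto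
      finally show ?case using elim(3) by (simp add: divide_less_eq mult.commute)
    qed
  qed
qed

section \<open>Studentised and normalised errors\<close>

text \<open>Here and below, \<open>F\<close> is the true density value, \<open>v\<close> the estimate, and
  \<open>(v - F) / q\<close> the estimation error in units of its standard deviation \<open>q\<close> (up to a
  logarithmic factor); the half-width carries \<open>sqrt (v / F)\<close> because it is Studentised.\<close>

lemma studentised_error_gt:
  fixes F q v r c :: real
  assumes "F > 0" "q > 0" "r \<ge> 0" "c > 0" and c: "r < c * (1 - r * q / (2 * F))" and v: "c \<le> (v - F) / q"
  shows "r * q * sqrt (v / F) < \<bar>v - F\<bar>"
proof -
  define Z where "Z = (v - F) / q"
  have Z: "v - F = Z * q" "c \<le> Z" using assms by (auto simp: Z_def)
  \<comment> \<open>By sqrt (1 + y) \<le> 1 + y/2 it is enough that r (1 + Z q / (2 F)) < Z. This is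
    affine in Z, so with a positive coefficient it need only be checked at Z = c.\<close>
  have "c * (1 - r * q / (2 * F)) > 0" using c assms(3) by linarith
  then have "1 - r * q / (2 * F) > 0" using \<open>c > 0\<close> by (simp add: zero_less_mult_iff)
  then have "c * (1 - r * q / (2 * F)) \<le> Z * (1 - r * q / (2 * F))" using Z by (intro mult_right_mono) auto
  with c have 1: "r * (1 + Z * q / (2 * F)) < Z" by (simp add: algebra_simps)
  have "v / F = 1 + Z * q / F" using Z(1) assms(1) by (simp add: field_simps)
  also have "\<dots> \<le> \<dots> + (Z * q / (2 * F))\<^sup>2" by simp
  also have "\<dots> = (1 + Z * q / (2 * F))\<^sup>2" by (simp add: power2_sum)
  finally have "sqrt (v / F) \<le> 1 + Z * q / (2 * F)" using assms Z(2) by (intro real_le_lsqrt) auto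
  then have "r * sqrt (v / F) \<le> r * (1 + Z * q / (2 * F))" using assms(3) by (rule mult_left_mono)
  with 1 have "r * sqrt (v / F) * q < Z * q" using assms(2) by (intro mult_strict_right_mono) auto
  then show ?thesis unfolding Z(1) by (simp add: mult_ac)
qed

text \<open>For a small error the estimate is bounded below, v / F \<ge> 1 - c q / F, whatever the
  sign of the error. The random half-width is then at least its value at that deterministic
  bound.\<close>

lemma studentised_error_le:
  fixes F q v r c :: real
  assumes "F > 0" "q > 0" "r \<ge> 0" and c: "c \<le> r * sqrt (1 - c * q / F)" and v: "\<bar>(v - F) / q\<bar> < c"
  shows "\<bar>v - F\<bar> \<le> r * q * sqrt (v / F)"
proof -
  define Z where "Z = (v - F) / q"
  have Z: "v - F = Z * q" "\<bar>Z\<bar> < c" using assms by (auto simp: Z_def)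
  have "v / F = 1 - (- Z) * q / F" using Z(1) assms(1) by (simp add: field_simps)
  also have "\<dots> \<ge> 1 - c * q / F" using Z(2) assms by (intro diff_left_mono divide_right_mono mult_right_mono) auto
  finally have "r * sqrt (1 - c * q / F) \<le> r * sqrt (v / F)" using assms(3) by (intro mult_left_mono) auto
  then have "\<bar>Z\<bar> \<le> r * sqrt (v / F)" using c Z(2) by linarith
  then have "\<bar>Z\<bar> * q \<le> r * sqrt (v / F) * q" using assms(2) by (intro mult_right_mono) auto
  then show ?thesis unfolding Z(1) using assms(2) by (simp add: abs_mult mult_ac)
qed

section \<open>Asymptotics of the bandwidth\<close>

text \<open>The last two quantities are of order log n / n^(1 - a) and n^(1 - 5 a) / log n, so the
  signs of 1 - a and 5 a - 1 decide.\<close>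

lemma bandwidth_limits:
  fixes a :: real
  assumes a: "1 / 5 < a" "a < 1 / 2"
  shows "(\<lambda>n. real n powr (- a)) \<longlonglongrightarrow> 0"
    and "filterlim (\<lambda>n. ln (1 / real n powr (- a))) at_top sequentially"
    and "(\<lambda>n. ln (1 / real n powr (- a)) / (real n * real n powr (- a))) \<longlonglongrightarrow> 0"
    and "(\<lambda>n. real n * (real n powr (- a)) ^ 5 / ln (1 / real n powr (- a))) \<longlonglongrightarrow> 0"
proof -
  have a': "a > 0" "1 - a > 0" "5 * a - 1 > 0" using a by auto
  \<comment> \<open>At n = 0 both sides are 0, by the conventions for \<open>powr\<close>, division
    and \<open>ln\<close> at 0.\<close>
  have ln: "ln (1 / real n powr (- a)) = a * ln (real n)" for n
    by (cases "n = 0") (auto simp: ln_div ln_powr)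
  show "(\<lambda>n. real n powr (- a)) \<longlonglongrightarrow> 0" using a' by real_asymp
  show l: "filterlim (\<lambda>n. ln (1 / real n powr (- a))) at_top sequentially"
    unfolding ln using a' by real_asymp
  have "(\<lambda>n. a * ln (real n) * real n powr (- (1 - a))) \<longlonglongrightarrow> 0" using a' by real_asymp
  then show "(\<lambda>n. ln (1 / real n powr (- a)) / (real n * real n powr (- a))) \<longlonglongrightarrow> 0"
    unfolding ln
  proof (rule Lim_transform_eventually)
    show "\<forall>\<^sub>F n in sequentially. a * ln (real n) * real n powr (- (1 - a)) = a * ln (real n) / (real n * real n powr (- a))"
      using eventually_gt_at_top[of 0]
    proof eventually_elim
      case (elim n)
      have "real n * real n powr (- a) = real n powr (1 - a)" using elim by (simp add: powr_diff powr_minus field_simps)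
      then show ?case by (simp only: powr_minus_divide) simp
    qed
  qed
  have "(\<lambda>n. real n powr (- (5 * a - 1))) \<longlonglongrightarrow> 0" using a' by real_asymp
  moreover have "(\<lambda>n. inverse (ln (1 / real n powr (- a)))) \<longlonglongrightarrow> 0"
    by (rule tendsto_inverse_0_at_top[OF l])
  ultimately have "(\<lambda>n. real n powr (- (5 * a - 1)) * inverse (ln (1 / real n powr (- a)))) \<longlonglongrightarrow> 0"
    by (rule tendsto_mult_zero)
  then show "(\<lambda>n. real n * (real n powr (- a)) ^ 5 / ln (1 / real n powr (- a))) \<longlonglongrightarrow> 0"
  proof (rule Lim_transform_eventually)
    show "\<forall>\<^sub>F n in sequentially. real n powr (- (5 * a - 1)) * inverse (ln (1 / real n powr (- a)))
        = real n * (real n powr (- a)) ^ 5 / ln (1 / real n powr (- a))"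
      using eventually_gt_at_top[of 0]
    proof eventually_elim
      case (elim n)
      have "(real n powr (- a)) ^ 5 = real n powr (- (5 * a))" using elim by (simp flip: powr_realpow add: powr_powr mult.commute)
      then have "real n powr (- (5 * a - 1)) = real n * (real n powr (- a)) ^ 5"
        using elim by (simp add: powr_diff powr_minus field_simps)
      then show ?case by (simp add: divide_inverse)
    qed
  qed
qed

section \<open>Non-coverage probability of the confidence intervals\<close>

theorem mainTheorem5:
  fixes M :: "'a measure" and X :: "nat \<Rightarrow> 'a \<Rightarrow> real"
    and f K :: "real \<Rightarrow> real"
    and c1 c2 a \<alpha> z \<kappa> :: real
    and h u l :: "nat \<Rightarrow> real"
    and fn :: "nat \<Rightarrow> real \<Rightarrow> 'a \<Rightarrow> real"
    and I :: "nat \<Rightarrow> real \<Rightarrow> 'a \<Rightarrow> real set"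
  assumes "prob_space M"
    and "prob_space.indep_vars M (\<lambda>_. borel) X {1..}"
    and "\<And>j. j \<ge> 1 \<Longrightarrow> distributed M lborel (X j) (\<lambda>x. ennreal (f x))"
    and "\<And>x. 0 \<le> f x"
    and "bounded (range f)"
    and "c1 < c2"
    and "\<exists>m>0. \<forall>x\<in>{c1..c2}. m \<le> f x"
    and "\<And>x. x \<in> {c1..c2} \<Longrightarrow> twice_differentiable_at f x"
    and "bounded (range K)"
    and "\<And>t. 0 \<le> K t"
    and "(K \<longlongrightarrow> 0) at_infinity"
    and "has_bochner_integral lborel K 1"
    and "has_bochner_integral lborel (\<lambda>t. t * K t) 0"
    and "integrable lborel (\<lambda>t. t\<^sup>2 * \<bar>K t\<bar>)"
    and "absolutely_continuous_fun_on UNIV K"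
    and "integrable lborel (\<lambda>t. (deriv K t)\<^sup>2)"
    and "0 < (\<integral>t. (deriv K t)\<^sup>2 \<partial>lborel)"
    and \<kappa>: "\<kappa> = (\<integral>t. (K t)\<^sup>2 \<partial>lborel)"
    and "a \<in> {1/5<..<1/2}"
    and h: "\<And>n. h n = real n powr (- a)"
    and "\<alpha> \<in> {0<..<1}"
    and z: "exp (- 2 * exp (- z)) = 1 - \<alpha>"
    and u: "\<And>n. n \<ge> 2 \<Longrightarrow> u n = 1 / (sqrt 2 * ln (1 / h n)) *
          (ln (1 / (2 * pi) * sqrt ((\<integral>t. (deriv K t)\<^sup>2 \<partial>lborel) / \<kappa>)) + ln ((c2 - c1) / pi))"
    and l: "\<And>n. n \<ge> 2 \<Longrightarrow> l n = sqrt (ln (1 / h n)) *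
          (sqrt 2 + u n + z / (sqrt 2 * ln (1 / h n)))"
    and fn: "fn = kernel_density_estimator K h X"
    and I: "\<And>n x \<omega>. n \<ge> 2 \<Longrightarrow> x \<in> {c1..c2} \<Longrightarrow> I n x \<omega> =
          {fn n x \<omega> - sqrt (fn n x \<omega> * \<kappa>) / sqrt (real n * h n) * l n ..
           fn n x \<omega> + sqrt (fn n x \<omega> * \<kappa>) / sqrt (real n * h n) * l n}"
  shows "\<forall>x\<in>{c1..c2}.
           prob_space.has_log_asymptotic_level M (\<lambda>n. I n x) (f x) 1 (\<lambda>n. ln (1 / h n))"
proof
  fix x assume x: "x \<in> {c1..c2}"
  interpret prob_space M by (fact assms(1))
  define b where "b n = ln (1 / h n)" for n
  have a: "1 / 5 < a" "a < 1 / 2" using assms(19) by auto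
  obtain B where "\<And>t. norm (K t) \<le> B" using assms(9) by (auto simp: bounded_iff)
  then have B: "K t \<le> B" for t by (simp add: abs_le_iff)
  have B0: "0 \<le> B" using B assms(10) order_trans by blast
  obtain m where m: "m > 0" "\<forall>x\<in>{c1..c2}. m \<le> f x" using assms(7) by blast
  have F: "f x > 0" using m x by (meson less_le_trans)
  have iK: "integrable lborel K" "(\<integral>t. K t \<partial>lborel) = 1"
    using assms(12) by (auto simp: has_bochner_integral_iff)
  have [measurable]: "K \<in> borel_measurable borel" using borel_measurable_integrable[OF iK(1)] by simp
  have \<kappa>0: "\<kappa> > 0"
  proof -
    have i: "integrable lborel (\<lambda>t. (K t)\<^sup>2)"
    proof (rule Bochner_Integration.integrable_bound)
      show "integrable lborel (\<lambda>t. B * K t)" using iK by simp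
      show "AE t in lborel. norm ((K t)\<^sup>2) \<le> norm (B * K t)"
        using B assms(10) B0 by (auto intro!: AE_I2 mult_right_mono simp: power2_eq_square abs_mult)
    qed measurable
    have "\<kappa> \<noteq> 0"
    proof
      assume "\<kappa> = 0"
      then have "AE t in lborel. (K t)\<^sup>2 = 0"
        using integral_nonneg_eq_0_iff_AE[OF i] by (simp add: \<kappa>)
      then have "AE t in lborel. K t = 0" by simp
      then have "(\<integral>t. K t \<partial>lborel) = 0" by (rule integral_eq_zero_AE)
      then show False using iK by simp
    qed
    moreover have "\<kappa> \<ge> 0" by (simp add: \<kappa>)
    ultimately show ?thesis by simp
  qed
  have hfun: "h = (\<lambda>n. real n powr (- a))" using h by auto
  note lims = bandwidth_limits[OF a, folded hfun, unfolded h[symmetric], folded b_def]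
  have hpos: "h n > 0" if "n \<ge> 2" for n using that by (simp add: h)
  have bpos: "b n > 0" if "n \<ge> 2" for n
    using that a by (simp add: b_def h ln_div ln_powr)
  have K2: "integrable lborel (\<lambda>t. t\<^sup>2 * K t)" using assms(14) assms(10) by simp
  define q where "q n = sqrt (\<kappa> * f x * b n / (real n * h n))" for n
  define Z where "Z n \<omega> = (fn n x \<omega> - f x) / q n" for n \<omega>
  \<comment> \<open>The half-width factors as r q sqrt (fn / f(x)): a deterministic threshold in
    units of q and a random factor near 1.\<close>
  define r where "r n = l n / sqrt (b n)" for n
  have qpos: "q n > 0" if "n \<ge> 2" for n
    using \<kappa>0 F hpos[OF that] bpos[OF that] that by (auto simp: q_def)
  have q0: "q \<longlonglongrightarrow> 0"
  proof -
    have "q \<longlonglongrightarrow> sqrt (\<kappa> * f x * 0)"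
      unfolding q_def times_divide_eq_right[symmetric] by (intro tendsto_intros lims)
    then show ?thesis by simp
  qed
  have r2: "r \<longlonglongrightarrow> sqrt 2"
  proof -
    \<comment> \<open>\<open>C\<close> collects the logarithms in \<open>u\<close>. Together with
      \<open>z\<close> it shifts the threshold from sqrt 2 by only (C + z) / (sqrt 2 b).\<close>
    define C where "C = ln (1 / (2 * pi) * sqrt ((\<integral>t. (deriv K t)\<^sup>2 \<partial>lborel) / \<kappa>)) + ln ((c2 - c1) / pi)"
    have "(\<lambda>n. inverse (b n)) \<longlonglongrightarrow> 0" using lims(2) by (rule tendsto_inverse_0_at_top)
    then have "(\<lambda>n. sqrt 2 + (C + z) / sqrt 2 * inverse (b n)) \<longlonglongrightarrow> sqrt 2 + (C + z) / sqrt 2 * 0"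
      by (intro tendsto_intros)
    then have "(\<lambda>n. sqrt 2 + (C + z) / sqrt 2 * inverse (b n)) \<longlonglongrightarrow> sqrt 2" by simp
    then show ?thesis
    proof (rule Lim_transform_eventually)
      show "\<forall>\<^sub>F n in sequentially. sqrt 2 + (C + z) / sqrt 2 * inverse (b n) = r n"
        using eventually_ge_at_top[of 2]
      proof eventually_elim
        case (elim n)
        have "r n = sqrt 2 + u n + z / (sqrt 2 * b n)"
          using bpos[OF elim] by (simp add: r_def l[OF elim] flip: b_def)
        also have "u n = C / (sqrt 2 * b n)" by (simp add: u[OF elim] C_def flip: b_def)
        also have "sqrt 2 + C / (sqrt 2 * b n) + z / (sqrt 2 * b n) = sqrt 2 + (C + z) / sqrt 2 * inverse (b n)"
          by (simp add: add_divide_distrib divide_inverse algebra_simps)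
        finally show ?case by simp
      qed
    qed
  qed
  have rpos: "\<forall>\<^sub>F n in sequentially. r n > 0" by (rule order_tendstoD[OF r2]) simp
  have X[measurable]: "random_variable borel (X j)" if "j \<ge> 1" for j
    using distributed_measurable[OF assms(3)[OF that]] by simp
  have fn_meas[measurable]: "random_variable borel (fn n x)" for n
    unfolding fn kernel_density_estimator_def
    by (intro borel_measurable_times borel_measurable_const borel_measurable_sum) (use X in measurable)
  have Zm[measurable]: "random_variable borel (Z n)" for n unfolding Z_def by measurable
  have fn0: "fn n x \<omega> \<ge> 0" for n \<omega>
    unfolding fn kernel_density_estimator_def by (intro mult_nonneg_nonneg sum_nonneg assms(10)) (auto simp: h)
  \<comment> \<open>The estimate is bounded because K is. No lower bound on n is required: for n < 2
    the scale \<open>q n\<close> is 0, so \<open>Z n\<close> is 0 as a quotient by zero.\<close>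
  have int: "integrable M (\<lambda>\<omega>. exp (\<eta> * b n * Z n \<omega>))" for \<eta> n
  proof -
    have "fn n x \<omega> \<le> 1 / (real n * h n) * (\<Sum>j = 1..n. B)" for \<omega>
      unfolding fn kernel_density_estimator_def by (intro mult_left_mono sum_mono B) (auto simp: h)
    then have "\<bar>fn n x \<omega> - f x\<bar> \<le> 1 / (real n * h n) * (\<Sum>j = 1..n. B) + f x" for \<omega>
      using fn0[of n \<omega>] F by (smt (verit))
    then have "\<bar>\<eta> * b n / q n\<bar> * \<bar>fn n x \<omega> - f x\<bar>
        \<le> \<bar>\<eta> * b n / q n\<bar> * (1 / (real n * h n) * (\<Sum>j = 1..n. B) + f x)" (is "_ \<le> ?C") for \<omega>
      by (intro mult_left_mono) auto
    moreover have "\<eta> * b n * Z n \<omega> \<le> \<bar>\<eta> * b n / q n\<bar> * \<bar>fn n x \<omega> - f x\<bar>" for \<omega>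
      unfolding Z_def abs_mult[symmetric] by (rule order_trans[OF abs_ge_self]) simp
    ultimately have "\<eta> * b n * Z n \<omega> \<le> ?C" for \<omega> by (meson order_trans)
    then show ?thesis by (intro integrable_const_bound[where B = "exp ?C"]) auto
  qed
  have mgf: "(\<lambda>n. ln (expectation (\<lambda>\<omega>. exp (\<eta> * b n * Z n \<omega>))) / b n) \<longlonglongrightarrow> \<eta>\<^sup>2 / 2" for \<eta>
    unfolding Z_def q_def fn
    by (rule kernel_density_log_mgf_tendsto[OF assms(2,3,4,5) F assms(8)[OF x] assms(10) B assms(12,13) K2
          \<kappa> \<kappa>0 hpos bpos lims(1,4,3)])
  \<comment> \<open>No sign of \<open>r n\<close> is assumed: a negative half-width gives an empty
    interval, and the right-hand side is then true as well.\<close>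
  have noncover: "f x \<notin> I n x \<omega> \<longleftrightarrow> r n * q n * sqrt (fn n x \<omega> / f x) < \<bar>fn n x \<omega> - f x\<bar>" if "n \<ge> 2" for n \<omega>
  proof -
    have "r n * q n * sqrt (fn n x \<omega> / f x) = l n * (q n / sqrt (b n) * sqrt (fn n x \<omega> / f x))"
      by (simp add: r_def)
    also have "q n / sqrt (b n) * sqrt (fn n x \<omega> / f x) = sqrt (fn n x \<omega> * \<kappa> / (real n * h n))"
      unfolding q_def using bpos[OF that] F
      by (simp flip: real_sqrt_divide real_sqrt_mult)
    finally have w: "sqrt (fn n x \<omega> * \<kappa>) / sqrt (real n * h n) * l n = r n * q n * sqrt (fn n x \<omega> / f x)"
      by (simp add: real_sqrt_divide)
    show ?thesis unfolding I[OF that x] w by (auto simp: abs_if)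
  qed
  define E where "E n = {\<omega> \<in> space M. f x \<notin> I n x \<omega>}" for n
  have "(\<lambda>n. ln (prob (E n)) / b n) \<longlonglongrightarrow> - ((sqrt 2)\<^sup>2 / 2)"
  proof (rule gaussian_two_sided_log_rate[OF Zm int lims(2) mgf])
    show "\<forall>\<^sub>F n in sequentially. E n \<in> events"
      using eventually_ge_at_top[of 2] by eventually_elim (simp add: E_def noncover)
  next
    fix c :: real assume c: "c > sqrt 2"
    \<comment> \<open>As q tends to 0, the condition of \<open>studentised_error_gt\<close> becomes
      sqrt 2 < c in the limit. The strict inequality leaves room for the Studentisation.\<close>
    have "(\<lambda>n. c * (1 - r n * q n / (2 * f x)) - r n) \<longlonglongrightarrow> c * (1 - sqrt 2 * 0 / (2 * f x)) - sqrt 2"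
      using F by (intro tendsto_intros q0 r2) auto
    then have "\<forall>\<^sub>F n in sequentially. c * (1 - r n * q n / (2 * f x)) - r n > 0"
      by (rule order_tendstoD) (use c in simp)
    then show "\<forall>\<^sub>F n in sequentially. {\<omega> \<in> space M. c \<le> Z n \<omega>} \<subseteq> E n"
      using rpos eventually_ge_at_top[of 2]
    proof eventually_elim
      case (elim n)
      have "c > 0" using c by (rule less_trans[rotated]) simp
      then show ?case
        using elim studentised_error_gt[OF F qpos[OF elim(3)], of "r n" c] by (auto simp: E_def noncover Z_def)
    qed
  next
    fix c :: real assume c: "0 < c" "c < sqrt 2"
    \<comment> \<open>Likewise the condition of \<open>studentised_error_le\<close> becomes c \<le>
      sqrt 2 in the limit, here with strict inequality.\<close>
    have "(\<lambda>n. r n * sqrt (1 - c * q n / f x)) \<longlonglongrightarrow> sqrt 2 * sqrt (1 - c * 0 / f x)"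
      using F by (intro tendsto_intros q0 r2) auto
    then have "\<forall>\<^sub>F n in sequentially. r n * sqrt (1 - c * q n / f x) > c"
      by (rule order_tendstoD) (use c in simp)
    then show "\<forall>\<^sub>F n in sequentially. E n \<subseteq> {\<omega> \<in> space M. c \<le> \<bar>Z n \<omega>\<bar>}"
      using rpos eventually_ge_at_top[of 2]
    proof eventually_elim
      case (elim n)
      show ?case
      proof
        fix \<omega> assume \<omega>: "\<omega> \<in> E n"
        have "\<not> \<bar>Z n \<omega>\<bar> < c"
        proof
          assume "\<bar>Z n \<omega>\<bar> < c"
          then have "\<bar>fn n x \<omega> - f x\<bar> \<le> r n * q n * sqrt (fn n x \<omega> / f x)"
            using elim by (intro studentised_error_le[OF F qpos[OF elim(3)], of _ c]) (auto simp: Z_def)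
          then show False using \<omega> elim(3) by (simp add: E_def noncover)
        qed
        then show "\<omega> \<in> {\<omega> \<in> space M. c \<le> \<bar>Z n \<omega>\<bar>}" using \<omega> by (simp add: E_def)
      qed
    qed
  qed simp
  then show "has_log_asymptotic_level (\<lambda>n. I n x) (f x) 1 (\<lambda>n. ln (1 / h n))"
    unfolding has_log_asymptotic_level_def by (simp add: E_def b_def)
qed

end
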